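(* Let $G=(V,E)$ be an infinite, locally finite, connected graph with a fixed vertex $x_0$. If there is a constant $c$ such that for all vertices $x$ of $G$ $$\frac{m_{+1}(x)-m_{-1}(x)}{m(x)}\ge c>0,$$ then $$\lambda_0(\Delta_{bd})\ge\frac{c^2}{2}.$$ If, in addition, $m(x)\ge m$ for all vertices $x$, for a constant $m$, then $$\lambda_0(\Delta)\ge\frac{c^2}{2}\,m.$$
   Context: $m(x)$ is the valence (number of edges at $x$), $y\sim x$ means $x,y$ are joined by an edge, $d$ is the graph distance and $r(x)=d(x,x_0)$. Put $m_{+1}(x)=\#\{y: y\sim x,\ r(y)=r(x)+1\}$ and $m_{-1}(x)=\#\{y: y\sim x,\ r(y)=r(x)-1\}$. The Laplacian is $\Delta f(x)=\sum_{y\sim x}(f(x)-f(y))$ and the bounded Laplacian is $\Delta_{bd}f(x)=\frac{1}{m(x)}\Delta f(x)$. With $\langle f,g\rangle=\sum_{x\in V}f(x)g(x)$ and $\langle f,g\rangle_{bd}=\sum_{x\in V}f(x)g(x)m(x)$, the bottoms of the spectra are $$\lambda_0(\Delta)=\inf\frac{\langle\Delta f,f\rangle}{\langle f,f\rangle},\qquad \lambda_0(\Delta_{bd})=\inf\frac{\langle\Delta_{bd}f,f\rangle_{bd}}{\langle f,f\rangle_{bd}},$$ the infima being over all finitely supported functions $f:V\to\mathbf{R}$, $f\not\equiv0$. *)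

theory Defs
  imports
    "HOL-Analysis.Analysis"
    "Graph_Theory.Digraph_Component"
    "Graph_Theory.Arc_Walk"
begin

text \<open>
  A simple graph is represented as a symmetric digraph without loops and multiple arcs: an
  (undirected) edge between \<open>x\<close> and \<open>y\<close> is a pair of opposite arcs. The library locale
  \<open>graph\<close> also demands finitely many vertices; here only local finiteness is required.
  The valence of \<open>x\<close> is \<open>out_degree G x\<close>, and \<open>y\<close> is a neighbour of \<open>x\<close> iff
  \<open>x \<rightarrow>\<^bsub>G\<^esub> y\<close>.
\<close>

locale locally_finite_graph = sym_digraph + loopfree_digraph + nomulti_digraph +
  assumes finite_out_arcs: "x \<in> verts G \<Longrightarrow> finite (out_arcs G x)"

definition graph_dist :: "('a, 'b) pre_digraph \<Rightarrow> 'a \<Rightarrow> 'a \<Rightarrow> nat" where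
  "graph_dist G x y = (LEAST n. \<exists>p. pre_digraph.awalk G x p y \<and> length p = n)"

definition m_plus :: "('a, 'b) pre_digraph \<Rightarrow> 'a \<Rightarrow> 'a \<Rightarrow> nat" where
  "m_plus G x0 x = card {y. x \<rightarrow>\<^bsub>G\<^esub> y \<and> graph_dist G y x0 = graph_dist G x x0 + 1}"

text \<open>The equation \<open>r y = r x - 1\<close> is written without the truncated subtraction of \<open>nat\<close>.\<close>

definition m_minus :: "('a, 'b) pre_digraph \<Rightarrow> 'a \<Rightarrow> 'a \<Rightarrow> nat" where
  "m_minus G x0 x = card {y. x \<rightarrow>\<^bsub>G\<^esub> y \<and> graph_dist G y x0 + 1 = graph_dist G x x0}"

definition laplacian :: "('a, 'b) pre_digraph \<Rightarrow> ('a \<Rightarrow> real) \<Rightarrow> 'a \<Rightarrow> real" where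
  "laplacian G f x = (\<Sum>y | x \<rightarrow>\<^bsub>G\<^esub> y. f x - f y)"

definition laplacian_bd :: "('a, 'b) pre_digraph \<Rightarrow> ('a \<Rightarrow> real) \<Rightarrow> 'a \<Rightarrow> real" where
  "laplacian_bd G f x = 1 / real (out_degree G x) * laplacian G f x"

definition inner_prod :: "('a, 'b) pre_digraph \<Rightarrow> ('a \<Rightarrow> real) \<Rightarrow> ('a \<Rightarrow> real) \<Rightarrow> real" where
  "inner_prod G f g = (\<Sum>\<^sub>\<infinity>x\<in>verts G. f x * g x)"

definition inner_prod_bd :: "('a, 'b) pre_digraph \<Rightarrow> ('a \<Rightarrow> real) \<Rightarrow> ('a \<Rightarrow> real) \<Rightarrow> real" where
  "inner_prod_bd G f g = (\<Sum>\<^sub>\<infinity>x\<in>verts G. f x * g x * real (out_degree G x))"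

text \<open>
  Functions on the vertex set are total functions whose values outside \<open>verts G\<close> are
  irrelevant: neither the inner products nor the Laplacians at vertices depend on them.
\<close>

definition test_functions :: "('a, 'b) pre_digraph \<Rightarrow> ('a \<Rightarrow> real) set" where
  "test_functions G =
     {f. finite {x \<in> verts G. f x \<noteq> 0} \<and> (\<exists>x\<in>verts G. f x \<noteq> 0)}"

text \<open>
  For a nonempty locally finite graph the set of quotients defining \<open>lambda0\<close> is nonempty and
  bounded below by 0, so the real infimum is the usual one; the same holds for \<open>lambda0_bd\<close>.
\<close>

definition lambda0 :: "('a, 'b) pre_digraph \<Rightarrow> real" where
  "lambda0 G = (INF f\<in>test_functions G. inner_prod G (laplacian G f) f / inner_prod G f f)"

definition lambda0_bd :: "('a, 'b) pre_digraph \<Rightarrow> real" where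
  "lambda0_bd G =
     (INF f\<in>test_functions G. inner_prod_bd G (laplacian_bd G f) f / inner_prod_bd G f f)"

end

theory Submission
  imports Defs
begin

text \<open>
  Green's formula for the distance \<open>r\<close> from \<open>x0\<close> and \<open>f\<^sup>2\<close> bounds \<open>c \<cdot> \<Sum> f\<^sup>2 m\<close> by
  \<open>(1/2) \<cdot> \<Sum> (r y - r x) (f x\<^sup>2 - f y\<^sup>2)\<close> over ordered pairs of neighbours. Since
  \<open>r\<close> is 1-Lipschitz, each term is at most \<open>\<bar>f x - f y\<bar> \<cdot> \<bar>f x + f y\<bar>\<close>, which the
  weighted AM-GM inequality splits into a multiple of the Dirichlet form of \<open>f\<close> and a part
  that is absorbed by \<open>(c/2) \<cdot> \<Sum> f\<^sup>2 m\<close>.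
\<close>

context locally_finite_graph
begin

lemma neighbours_eq: "{y. x \<rightarrow> y} = head G ` out_arcs G x"
  by (auto simp: arcs_ends_conv out_arcs_def)

lemma finite_neighbours: "finite {y. x \<rightarrow> y}"
proof (cases "x \<in> verts G")
  case True
  then show ?thesis by (simp add: neighbours_eq finite_out_arcs)
next
  case False
  then have "{y. x \<rightarrow> y} = {}" by auto
  then show ?thesis by (simp del: empty_Collect_eq)
qed

text \<open>Without parallel arcs, an outgoing arc is determined by its head.\<close>

lemma out_degree_eq_card_neighbours: "out_degree G x = card {y. x \<rightarrow> y}"
proof -
  have "inj_on (head G) (out_arcs G x)"
    by (rule inj_onI) (auto simp: out_arcs_def arc_to_ends_def intro: no_multi_arcs)
  then show ?thesis
    unfolding neighbours_eq out_degree_def by (simp add: card_image)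
qed

text \<open>Prepend the arc to a shortest walk from \<open>y\<close> to \<open>z\<close>.
  Connectedness provides such a walk, so that the \<open>LEAST\<close> in \<open>graph_dist\<close>
  is attained. Using the bound for both orientations of an edge shows that the distance is
  1-Lipschitz.\<close>

lemma graph_dist_adjacent_le:
  assumes "Digraph_Component.connected G" "z \<in> verts G" "x \<rightarrow> y"
  shows "graph_dist G x z \<le> graph_dist G y z + 1"
proof -
  obtain e where e: "e \<in> arcs G" "tail G e = x" "head G e = y"
    using assms(3) by auto
  have "y \<in> verts G" using e by auto
  then have "y \<rightarrow>\<^sup>*\<^bsub>mk_symmetric G\<^esub> z"
    using assms(1,2) by (auto simp: connected_def strongly_connected_def)
  \<comment> \<open>Connectedness speaks of the symmetrized digraph; since the arcs are already
    symmetric, reachability is the same in \<open>G\<close>.\<close>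
  then have "y \<rightarrow>\<^sup>* z"
    using reachable_mk_symmetric_eq[OF sym_arcs] by blast
  then have "\<exists>n p. awalk y p z \<and> length p = n"
    by (simp add: reachable_awalk)
  then have "\<exists>p. awalk y p z \<and> length p = graph_dist G y z"
    unfolding graph_dist_def by (rule LeastI_ex)
  then obtain p where p: "awalk y p z" "length p = graph_dist G y z" by blast
  have "awalk x (e # p) z" using e p(1) by (auto simp: awalk_Cons_iff)
  then show ?thesis
    unfolding graph_dist_def[of G x z] using p(2)
    by (intro Least_le exI[of _ "e # p"]) simp
qed

text \<open>Across an edge the distance changes by -1, 0 or 1, so the sum merely counts outward
  minus inward neighbours. This turns the hypothesis on valences into a bound on the Laplacian of
  the distance.\<close>

lemma sum_graph_dist_diff:
  assumes "Digraph_Component.connected G" "z \<in> verts G"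
  shows "(\<Sum>y | x \<rightarrow> y. real (graph_dist G y z) - real (graph_dist G x z))
    = real (m_plus G z x) - real (m_minus G z x)"
proof -
  let ?r = "\<lambda>x. graph_dist G x z"
  have "(\<Sum>y | x \<rightarrow> y. real (?r y) - real (?r x))
      = (\<Sum>y | x \<rightarrow> y. of_bool (?r y = ?r x + 1) - of_bool (?r y + 1 = ?r x))"
  proof (rule sum.cong[OF refl], clarify)
    fix y assume "x \<rightarrow> y"
    note le = graph_dist_adjacent_le[OF assms \<open>x \<rightarrow> y\<close>]
      graph_dist_adjacent_le[OF assms arcs_ends_symmetric[OF sym_arcs \<open>x \<rightarrow> y\<close>]]
    from le show "real (?r y) - real (?r x)
        = of_bool (?r y = ?r x + 1) - of_bool (?r y + 1 = ?r x)"
      by (auto simp: of_bool_def)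
  qed
  also have "\<dots> = real (m_plus G z x) - real (m_minus G z x)"
    unfolding m_plus_def m_minus_def
    by (simp add: sum_subtractf finite_neighbours sum.If_cases of_bool_def Int_def)
  finally show ?thesis .
qed

text \<open>The analytic core, with the distance abstracted to a function \<open>r\<close>. Both
  Rayleigh quotients have the Dirichlet form on the right as numerator, so this one estimate serves
  both infima.\<close>

lemma dirichlet_form_ge:
  fixes f r :: "'a \<Rightarrow> real" and c :: real
  defines "F \<equiv> {x \<in> verts G. f x \<noteq> 0}"
  assumes fin: "finite F" and c: "c > 0"
    and lipschitz: "\<And>x y. x \<rightarrow> y \<Longrightarrow> \<bar>r y - r x\<bar> \<le> 1"
    and drift: "\<And>x. x \<in> verts G \<Longrightarrow> c * real (out_degree G x) \<le> (\<Sum>y | x \<rightarrow> y. r y - r x)"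
  shows "c\<^sup>2 / 2 * (\<Sum>x\<in>F. (f x)\<^sup>2 * real (out_degree G x)) \<le> (\<Sum>x\<in>F. laplacian G f x * f x)"
proof -
  \<comment> \<open>Adding the neighbours of the support makes \<open>P\<close> a finite symmetric
    set of ordered edges that contains every edge meeting the support; symmetry permits swapping
    \<open>x\<close> and \<open>y\<close> in sums.\<close>
  define A where "A = F \<union> (\<Union>x\<in>F. {y. x \<rightarrow> y})"
  define P where "P = {(x, y). x \<in> A \<and> y \<in> A \<and> x \<rightarrow> y}"
  have finA: "finite A" using fin finite_neighbours by (simp add: A_def)
  have finP: "finite P"
    by (rule finite_subset[of _ "A \<times> A"]) (auto simp: P_def finA)
  have P_sym: "(y, x) \<in> P" if "(x, y) \<in> P" for x y
    using that arcs_ends_symmetric[OF sym_arcs] by (auto simp: P_def)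
  have sum_swap: "(\<Sum>(x, y)\<in>P. h y x) = (\<Sum>(x, y)\<in>P. h x y)" for h :: "'a \<Rightarrow> 'a \<Rightarrow> real"
    by (rule sum.reindex_bij_witness[of _ "\<lambda>(x, y). (y, x)" "\<lambda>(x, y). (y, x)"])
      (auto dest: P_sym)
  \<comment> \<open>The extra pairs of \<open>P\<close> start outside the support, where
    \<open>h\<close> vanishes.\<close>
  have sum_P: "(\<Sum>x\<in>F. \<Sum>y | x \<rightarrow> y. h x y) = (\<Sum>(x, y)\<in>P. h x y)"
    if "\<And>x y. f x = 0 \<Longrightarrow> h x y = 0" for h :: "'a \<Rightarrow> 'a \<Rightarrow> real"
  proof -
    have "(\<Sum>x\<in>F. \<Sum>y | x \<rightarrow> y. h x y) = (\<Sum>(x, y)\<in>Sigma F (\<lambda>x. {y. x \<rightarrow> y}). h x y)"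
      using fin finite_neighbours by (intro sum.Sigma) auto
    also have "\<dots> = (\<Sum>(x, y)\<in>P. h x y)"
    proof (rule sum.mono_neutral_left[OF finP])
      show "Sigma F (\<lambda>x. {y. x \<rightarrow> y}) \<subseteq> P" by (auto simp: P_def A_def)
      show "\<forall>p\<in>P - Sigma F (\<lambda>x. {y. x \<rightarrow> y}). (case p of (x, y) \<Rightarrow> h x y) = 0"
        using that by (auto simp: P_def F_def)
    qed
    finally show ?thesis .
  qed

  define M where "M = (\<Sum>x\<in>F. (f x)\<^sup>2 * real (out_degree G x))"
  define E where "E = (\<Sum>x\<in>F. laplacian G f x * f x)"
  have M_P: "M = (\<Sum>(x, y)\<in>P. (f x)\<^sup>2)"
  proof -
    have "M = (\<Sum>x\<in>F. \<Sum>y | x \<rightarrow> y. (f x)\<^sup>2)"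
      by (simp add: M_def out_degree_eq_card_neighbours mult.commute)
    also have "\<dots> = (\<Sum>(x, y)\<in>P. (f x)\<^sup>2)" by (rule sum_P) simp
    finally show ?thesis .
  qed
  have E_P: "E = (\<Sum>(x, y)\<in>P. (f x - f y) * f x)"
  proof -
    have "E = (\<Sum>x\<in>F. \<Sum>y | x \<rightarrow> y. (f x - f y) * f x)"
      by (simp add: E_def laplacian_def sum_distrib_right)
    also have "\<dots> = (\<Sum>(x, y)\<in>P. (f x - f y) * f x)" by (rule sum_P) simp
    finally show ?thesis .
  qed
  have "c * M \<le> (\<Sum>x\<in>F. (\<Sum>y | x \<rightarrow> y. r y - r x) * (f x)\<^sup>2)"
    unfolding M_def sum_distrib_left
  proof (rule sum_mono)
    fix x assume "x \<in> F"
    then have "x \<in> verts G" by (simp add: F_def)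
    from mult_right_mono[OF drift[OF this], of "(f x)\<^sup>2"]
    show "c * ((f x)\<^sup>2 * real (out_degree G x)) \<le> (\<Sum>y | x \<rightarrow> y. r y - r x) * (f x)\<^sup>2"
      by (simp add: mult_ac)
  qed
  also have "\<dots> = (\<Sum>(x, y)\<in>P. (r y - r x) * (f x)\<^sup>2)"
    unfolding sum_distrib_right by (rule sum_P) simp
  finally have cM: "c * M \<le> (\<Sum>(x, y)\<in>P. (r y - r x) * (f x)\<^sup>2)" .

  have edge: "(r y - r x) * ((f x)\<^sup>2 - (f y)\<^sup>2)
      \<le> (f x - f y)\<^sup>2 / c + c / 2 * ((f x)\<^sup>2 + (f y)\<^sup>2)" if "x \<rightarrow> y" for x y
  proof -
    let ?a = "\<bar>f x - f y\<bar>" and ?b = "\<bar>f x + f y\<bar>"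
    have "(r y - r x) * ((f x)\<^sup>2 - (f y)\<^sup>2) \<le> \<bar>r y - r x\<bar> * \<bar>(f x)\<^sup>2 - (f y)\<^sup>2\<bar>"
      by (metis abs_ge_self abs_mult)
    also have "\<dots> \<le> 1 * \<bar>(f x)\<^sup>2 - (f y)\<^sup>2\<bar>"
      by (intro mult_right_mono lipschitz that) simp
    also have "\<dots> = ?a * ?b"
      by (simp add: power2_eq_square square_diff_square_factored abs_mult mult.commute)
    also have "\<dots> \<le> ?a\<^sup>2 / c + c / 4 * ?b\<^sup>2"
    proof -
      \<comment> \<open>The weight is chosen so that the mass terms of \<open>edge\<close> sum to
        \<open>c * M\<close> over \<open>P\<close>, exactly half of the \<open>2 * c * M\<close> on
        the other side.\<close>
      have "0 \<le> (2 * ?a - c * ?b)\<^sup>2 / (4 * c)" using c by simp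
      also have "\<dots> = ?a\<^sup>2 / c + c / 4 * ?b\<^sup>2 - ?a * ?b"
        using c by (simp add: power2_eq_square field_simps)
      finally show ?thesis by simp
    qed
    also have "\<dots> \<le> (f x - f y)\<^sup>2 / c + c / 2 * ((f x)\<^sup>2 + (f y)\<^sup>2)"
    proof -
      have "(f x + f y)\<^sup>2 \<le> 2 * ((f x)\<^sup>2 + (f y)\<^sup>2)"
        using zero_le_power2[of "f x - f y"] by (simp add: power2_sum power2_diff)
      from mult_left_mono[OF this, of "c / 4"] c show ?thesis by simp
    qed
    finally show ?thesis .
  qed

  \<comment> \<open>Green's formula: average the sum with its copy under swapping \<open>x\<close>
    and \<open>y\<close>, which flips the sign of \<open>r y - r x\<close>.\<close>
  have "2 * (\<Sum>(x, y)\<in>P. (r y - r x) * (f x)\<^sup>2)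
      = (\<Sum>(x, y)\<in>P. (r y - r x) * (f x)\<^sup>2) + (\<Sum>(x, y)\<in>P. (r x - r y) * (f y)\<^sup>2)"
    using sum_swap[of "\<lambda>x y. (r y - r x) * (f x)\<^sup>2"] by simp
  also have "\<dots> = (\<Sum>(x, y)\<in>P. (r y - r x) * ((f x)\<^sup>2 - (f y)\<^sup>2))"
    by (simp add: sum.distrib[symmetric] case_prod_unfold algebra_simps)
  also have "\<dots> \<le> (\<Sum>(x, y)\<in>P. (f x - f y)\<^sup>2 / c + c / 2 * ((f x)\<^sup>2 + (f y)\<^sup>2))"
    by (rule sum_mono) (use edge in \<open>auto simp: P_def\<close>)
  \<comment> \<open>Each squared difference splits into two terms exchanged by the swap, so the
    squares sum to \<open>2 * E\<close>.\<close>
  also have "\<dots> = (\<Sum>(x, y)\<in>P. (f x - f y) * f x) / c + (\<Sum>(x, y)\<in>P. (f y - f x) * f y) / c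
      + c / 2 * ((\<Sum>(x, y)\<in>P. (f x)\<^sup>2) + (\<Sum>(x, y)\<in>P. (f y)\<^sup>2))"
    unfolding sum_divide_distrib sum_distrib_left sum.distrib[symmetric] case_prod_unfold
    by (intro sum.cong refl) (simp add: add_divide_distrib[symmetric] power2_eq_square algebra_simps)
  also have "\<dots> = 2 * E / c + c * M"
    using sum_swap[of "\<lambda>x y. (f x - f y) * f x"] sum_swap[of "\<lambda>x y. (f x)\<^sup>2"]
    by (simp add: M_P E_P)
  \<comment> \<open>By \<open>cM\<close> the left side is at least \<open>2 * c * M\<close>, and one
    \<open>c * M\<close> is absorbed.\<close>
  finally have "c * M \<le> 2 * E / c" using cM by linarith
  then have "c\<^sup>2 / 2 * M \<le> E"
    using c by (simp add: field_simps power2_eq_square)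
  then show ?thesis by (simp add: M_def E_def)
qed

end

text \<open>Reduces the inner products to finite sums over the support of the test function
  \<open>f\<close>; the summand \<open>g\<close> may itself vanish at more points.\<close>

lemma infsum_support_eq_sum:
  fixes g f :: "'a \<Rightarrow> real"
  assumes "finite {x \<in> V. f x \<noteq> 0}" "\<And>x. f x = 0 \<Longrightarrow> g x = 0"
  shows "(\<Sum>\<^sub>\<infinity>x\<in>V. g x) = (\<Sum>x | x \<in> V \<and> f x \<noteq> 0. g x)"
proof -
  have "(\<Sum>\<^sub>\<infinity>x\<in>V. g x) = (\<Sum>\<^sub>\<infinity>x\<in>{x \<in> V. f x \<noteq> 0}. g x)"
    by (rule infsum_cong_neutral) (use assms(2) in auto)
  then show ?thesis using assms(1) by simp
qed

lemma test_functions_nonempty: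
  assumes "x \<in> verts G"
  shows "test_functions G \<noteq> {}"
proof -
  have "(\<lambda>y. of_bool (y = x)) \<in> test_functions G"
    using assms by (auto simp: test_functions_def)
  then show ?thesis by blast
qed

theorem theorem4p2p2:
  fixes G :: "('a, 'b) pre_digraph" and x0 :: 'a and c :: real
  assumes "locally_finite_graph G"
    and "infinite (verts G)"
    and "Digraph_Component.connected G"
    and "x0 \<in> verts G"
    and "c > 0"
    and "\<And>x. x \<in> verts G \<Longrightarrow>
           (real (m_plus G x0 x) - real (m_minus G x0 x)) / real (out_degree G x) \<ge> c"
  shows "lambda0_bd G \<ge> c\<^sup>2 / 2 \<and>
    (\<forall>m::real. (\<forall>x\<in>verts G. real (out_degree G x) \<ge> m) \<longrightarrow> lambda0 G \<ge> c\<^sup>2 / 2 * m)"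
proof -
  interpret locally_finite_graph G by (rule assms(1))
  define r where "r x = real (graph_dist G x x0)" for x
  \<comment> \<open>Division by zero yields 0, so at a vertex of degree 0 the hypothesis would read
    \<open>0 \<ge> c\<close>, contradicting \<open>c > 0\<close>.\<close>
  have deg_pos: "out_degree G x > 0" if "x \<in> verts G" for x
    using assms(5) assms(6)[OF that] by (auto intro: gr0I)
  have lipschitz: "\<bar>r y - r x\<bar> \<le> 1" if "x \<rightarrow>\<^bsub>G\<^esub> y" for x y
    using graph_dist_adjacent_le[OF assms(3,4) that]
      graph_dist_adjacent_le[OF assms(3,4) arcs_ends_symmetric[OF sym_arcs that]]
    by (auto simp: r_def abs_le_iff)
  have drift: "c * real (out_degree G x) \<le> (\<Sum>y | x \<rightarrow>\<^bsub>G\<^esub> y. r y - r x)" if "x \<in> verts G" for x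
    using assms(6)[OF that] deg_pos[OF that]
    by (simp add: r_def sum_graph_dist_diff[OF assms(3,4)] pos_le_divide_eq)
  define F where "F f = {x \<in> verts G. f x \<noteq> 0}" for f :: "'a \<Rightarrow> real"
  have energy: "c\<^sup>2 / 2 * (\<Sum>x\<in>F f. (f x)\<^sup>2 * real (out_degree G x)) \<le> (\<Sum>x\<in>F f. laplacian G f x * f x)"
    if "f \<in> test_functions G" for f
    unfolding F_def
    by (rule dirichlet_form_ge[of f c r]) (use that assms(5) lipschitz drift in \<open>auto simp: test_functions_def\<close>)
  have F: "finite (F f)" "F f \<noteq> {}" if "f \<in> test_functions G" for f
    using that by (auto simp: test_functions_def F_def)
  have nonempty: "test_functions G \<noteq> {}" by (rule test_functions_nonempty[OF assms(4)])
  have "c\<^sup>2 / 2 \<le> lambda0_bd G"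
    unfolding lambda0_bd_def
  proof (rule cINF_greatest[OF nonempty])
    fix f assume f: "f \<in> test_functions G"
    have "inner_prod_bd G (laplacian_bd G f) f
        = (\<Sum>x\<in>F f. laplacian_bd G f x * f x * real (out_degree G x))"
      unfolding inner_prod_bd_def F_def
      by (rule infsum_support_eq_sum) (use F(1)[OF f] in \<open>auto simp: F_def\<close>)
    \<comment> \<open>The weight of the inner product cancels the factor
      \<open>1 / real (out_degree G x)\<close> of the bounded Laplacian.\<close>
    also have "\<dots> = (\<Sum>x\<in>F f. laplacian G f x * f x)"
      by (rule sum.cong) (auto simp: F_def laplacian_bd_def dest: deg_pos)
    finally have num: "inner_prod_bd G (laplacian_bd G f) f = \<dots>" .
    have den: "inner_prod_bd G f f = (\<Sum>x\<in>F f. (f x)\<^sup>2 * real (out_degree G x))"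
      unfolding inner_prod_bd_def F_def power2_eq_square
      by (rule infsum_support_eq_sum) (use F(1)[OF f] in \<open>auto simp: F_def\<close>)
    have "0 < inner_prod_bd G f f"
      unfolding den by (rule sum_pos[OF F[OF f]]) (auto simp: F_def deg_pos)
    then show "c\<^sup>2 / 2 \<le> inner_prod_bd G (laplacian_bd G f) f / inner_prod_bd G f f"
      using energy[OF f] by (simp add: pos_le_divide_eq num den)
  qed
  moreover have "c\<^sup>2 / 2 * m \<le> lambda0 G"
    if m: "\<forall>x\<in>verts G. m \<le> real (out_degree G x)" for m :: real
    unfolding lambda0_def
  proof (rule cINF_greatest[OF nonempty])
    fix f assume f: "f \<in> test_functions G"
    have num: "inner_prod G (laplacian G f) f = (\<Sum>x\<in>F f. laplacian G f x * f x)"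
      unfolding inner_prod_def F_def
      by (rule infsum_support_eq_sum) (use F(1)[OF f] in \<open>auto simp: F_def\<close>)
    have den: "inner_prod G f f = (\<Sum>x\<in>F f. (f x)\<^sup>2)"
      unfolding inner_prod_def F_def power2_eq_square
      by (rule infsum_support_eq_sum) (use F(1)[OF f] in \<open>auto simp: F_def\<close>)
    have pos: "0 < inner_prod G f f"
      unfolding den by (rule sum_pos[OF F[OF f]]) (auto simp: F_def)
    \<comment> \<open>The valence bound compares the unweighted norm with the weighted one, to which
      \<open>energy\<close> applies.\<close>
    have "m * inner_prod G f f \<le> (\<Sum>x\<in>F f. (f x)\<^sup>2 * real (out_degree G x))"
      unfolding den sum_distrib_left
      by (rule sum_mono) (use m in \<open>auto simp: F_def mult.commute[of m] intro: mult_left_mono\<close>)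
    from mult_left_mono[OF this, of "c\<^sup>2 / 2"]
    have "c\<^sup>2 / 2 * m * inner_prod G f f \<le> inner_prod G (laplacian G f) f"
      using energy[OF f] by (simp add: num mult.assoc)
    then show "c\<^sup>2 / 2 * m \<le> inner_prod G (laplacian G f) f / inner_prod G f f"
      using pos by (simp add: pos_le_divide_eq)
  qed
  ultimately show ?thesis by blast
qed

end
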